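(* Let $p$ and $q$ be odd prime numbers with $p < 2q+1$. Then every prime divisor of the number $A = \dfrac{p^q-1}{p-1}$ is greater than $p$. *)

theory Defs
  imports Complex_Main "HOL-Computational_Algebra.Primes"
begin

end

theory Submission
  imports Defs "HOL-Number_Theory.Number_Theory"
begin

text \<open>
  Let \<open>r\<close> be a prime divisor of \<open>A = 1 + p + \<dots> + p ^ (q - 1)\<close>. As \<open>r\<close> divides \<open>p ^ q - 1\<close>, the order
  of \<open>p\<close> modulo \<open>r\<close> is \<open>1\<close> or \<open>q\<close>. If it is \<open>1\<close>, then \<open>A\<close> is congruent to \<open>q\<close> modulo \<open>r\<close>, so
  \<open>r = q\<close> divides \<open>p - 1\<close>; as \<open>p - 1\<close> is even, \<open>2 * q \<le> p - 1\<close>, which is excluded. If it is \<open>q\<close>,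
  then \<open>q\<close> divides \<open>r - 1\<close>, and since \<open>A\<close>, and hence \<open>r\<close>, is odd, \<open>r \<ge> 2 * q + 1 > p\<close>.
\<close>

lemma power_diff_1_eq_nat:
  fixes p :: nat
  assumes "p > 0"
  shows "p ^ n - 1 = (p - 1) * (\<Sum>i<n. p ^ i)"
proof -
  \<comment> \<open>Over \<open>int\<close> subtraction is not truncated, so the ring identity
    applies.\<close>
  have "int (p ^ n - 1) = int ((p - 1) * (\<Sum>i<n. p ^ i))"
    using assms by (simp add: of_nat_diff power_diff_1_eq)
  then show ?thesis by (simp only: of_nat_eq_iff)
qed

text \<open>2 and the odd \<open>q\<close> are coprime, so their product divides \<open>m\<close>;
  both cases of the theorem get their factor 2 here.\<close>

lemma double_le_of_odd_dvd_even:
  fixes q m :: nat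
  assumes "odd q" "q dvd m" "even m" "m > 0"
  shows "2 * q \<le> m"
proof -
  have "2 * q dvd m"
    using assms by (intro divides_mult) auto
  then show ?thesis using assms by (intro dvd_imp_le)
qed

theorem theorem2:
  fixes p q :: nat
  assumes "prime p" and "odd p"
    and "prime q" and "odd q"
    and "p < 2 * q + 1"
  shows "\<forall>r::nat. prime r \<and> r dvd (p ^ q - 1) div (p - 1) \<longrightarrow> r > p"
proof (intro allI impI, elim conjE)
  fix r :: nat
  assume r: "prime r" and "r dvd (p ^ q - 1) div (p - 1)"
  have p1: "p > 1" using assms(1) by (rule prime_gt_1_nat)
  have factored: "p ^ q - 1 = (p - 1) * (\<Sum>i<q. p ^ i)"
    using p1 by (intro power_diff_1_eq_nat) simp
  have rdvd: "r dvd (\<Sum>i<q. p ^ i)"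
    using \<open>r dvd _\<close> p1 unfolding factored by simp
  \<comment> \<open>An odd number of odd terms.\<close>
  have "odd (\<Sum>i<q. p ^ i)"
    using assms(2,4) by (simp add: even_sum_iff)
  then have "odd r" using rdvd dvd_trans by blast
  have "r dvd p ^ q - 1" unfolding factored using rdvd by (rule dvd_mult)
  then have pq: "[p ^ q = 1] (mod r)"
    using p1 by (simp add: cong_altdef_nat)
  have "ord r p dvd q" using pq by (simp only: ord_divides)
  then consider "ord r p = 1" | "ord r p = q"
    using assms(3) prime_nat_iff by blast
  then show "r > p"
  proof cases
    case 1
    have p_cong: "[p = 1] (mod r)" using 1 ord[of p r] by simp
    have "[(\<Sum>i<q. p ^ i) = (\<Sum>i<q. 1 ^ i)] (mod r)"
      by (intro cong_sum cong_pow p_cong)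
    \<comment> \<open>The right-hand sum is \<open>q\<close>.\<close>
    then have "r dvd q" using rdvd by (simp add: cong_dvd_iff)
    then have "r = q" using r assms(3) primes_dvd_imp_eq by blast
    then have "q dvd p - 1" using p_cong p1 by (simp add: cong_altdef_nat)
    then have "2 * q \<le> p - 1"
      using assms(2,4) p1 by (intro double_le_of_odd_dvd_even) auto
    then show ?thesis using assms(5) p1 by simp
  next
    case 2
    \<comment> \<open>A power of \<open>p\<close> with positive exponent is a unit modulo
      \<open>r\<close>, hence so is \<open>p\<close>, and Fermat's little theorem applies.\<close>
    have "q > 0" using assms(3) by (rule prime_gt_0_nat)
    moreover have "coprime (p ^ q) r"
      using cong_imp_coprime[OF cong_sym[OF pq]] by simp
    ultimately have "coprime p r" by simp
    then have "[p ^ (r - 1) = 1] (mod r)"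
      using euler_theorem[of p r] r by (simp only: totient_prime)
    then have "q dvd r - 1" using 2 by (simp only: ord_divides)
    then have "2 * q \<le> r - 1"
      using assms(4) \<open>odd r\<close> prime_gt_1_nat[OF r] by (intro double_le_of_odd_dvd_even) auto
    then show ?thesis using assms(5) prime_gt_1_nat[OF r] by simp
  qed
qed

end
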